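(* For every integer $n\ge 1$, as polynomials in $x,y,z$, $$ \sum_{T\in\mathcal{PT}_{\mathrm B}(n)} x^{\operatorname{urr}(T)-1}\, y^{\operatorname{top}_{0,1}(T)}\,z^{\operatorname{diag}(T)} = (1+z)^n\, (x+y)_{n-1}.$$
   Context: Rising factorial: $(x)_0=1$, $(x)_n=x(x+1)\cdots(x+n-1)$ for $n\ge1$. Shifted Ferrers diagrams: a Ferrers diagram $F$ of length $n$ (rows plus columns, empty rows and columns allowed) has its south-east border steps labeled $1,\dots,n$ from north-east to south-west; a row gets the label of its south step, a column the label of its west step. So $F$ amounts to a splitting of $\{1,\dots,n\}$ into row labels and column labels; rows go top to bottom in increasing label order, columns left to right in decreasing label order, and there is a cell in Row $r$, Column $c$ iff $r<c$. If $F$ has $k$ columns, the shifted Ferrers diagram $\overline F$ is obtained by adding $k$ left-justified rows of sizes $1,2,\dots,k$ (top to bottom) above $F$; its length is that of $F$. The rightmost cells of the added rows are the diagonal cells. The added row whose diagonal cell is in Column $j$ is labeled $-j$; thus Row $-j$ has a cell in Column $c$ iff $c\ge j$ ($c$ a column label), and rows are again ordered top to bottom by increasing label. Type B permutation tableaux: $\mathcal{PT}_{\mathrm B}(n)$ is the set of shifted Ferrers diagrams of length $n$ with a $0,1$-filling of the cells such that (1) each column has at least one $1$; (2) there is no $0$ having both a $1$ above it in the same column and a $1$ to the left of it in the same row; (3) if a diagonal cell contains $0$, there is no $1$ to the left of it in the same row. Statistics: a $0$ of $T\in\mathcal{PT}_{\mathrm B}(n)$ is restricted if it has a $1$ above it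 in the same column or it is in a diagonal cell. A row is unrestricted if it contains no restricted $0$. $\operatorname{urr}(T)$ is the number of unrestricted rows; $\operatorname{diag}(T)$ is the number of diagonal cells containing a $1$. Let Row $m$ be the topmost unrestricted row of $T$. Then $\operatorname{top}_{0,1}(T)$ is the number of $1$'s in Row $m$, not counting the $1$ in the diagonal cell if there is one, plus the number of rightmost restricted $0$'s (a restricted $0$ that is the rightmost restricted $0$ of its row) in Column $|m|$, if Column $|m|$ exists. *)

theory Defs
  imports Complex_Main
begin

text \<open>
  A tableau is a pair \<open>(C, f)\<close>: \<open>C \<subseteq> {1..n}\<close> is the set of column labels, which determines a
  (shifted) Ferrers diagram of length \<open>n\<close>, and \<open>f\<close> is the set of those cells (given as pairs of
  row label and column label) that contain a 1; the other cells of the diagram contain a 0.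

  Rows are ordered top to bottom by increasing label and columns left to right by \<^emph>\<open>decreasing\<close>
  label. So \<open>r' < r\<close> means that row \<open>r'\<close> is above row \<open>r\<close>, while \<open>c' > c\<close> means that column
  \<open>c'\<close> is to the left of column \<open>c\<close>. The diagonal cells are the cells \<open>(- c, c)\<close>.
\<close>

type_synonym tableau = "int set \<times> (int \<times> int) set"

definition row_labels :: "nat \<Rightarrow> int set \<Rightarrow> int set" where
  "row_labels n C = ({1..int n} - C) \<union> uminus ` C"

definition cells :: "nat \<Rightarrow> int set \<Rightarrow> (int \<times> int) set" where
  "cells n C = {(r, c). r \<in> {1..int n} - C \<and> c \<in> C \<and> r < c}
             \<union> {(- j, c) | j c. j \<in> C \<and> c \<in> C \<and> j \<le> c}"

definition one_above :: "tableau \<Rightarrow> int \<Rightarrow> int \<Rightarrow> bool" where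
  "one_above T r c \<longleftrightarrow> (\<exists>r' < r. (r', c) \<in> snd T)"

definition one_left :: "tableau \<Rightarrow> int \<Rightarrow> int \<Rightarrow> bool" where
  "one_left T r c \<longleftrightarrow> (\<exists>c' > c. (r, c') \<in> snd T)"

definition zero_at :: "nat \<Rightarrow> tableau \<Rightarrow> int \<Rightarrow> int \<Rightarrow> bool" where
  "zero_at n T r c \<longleftrightarrow> (r, c) \<in> cells n (fst T) \<and> (r, c) \<notin> snd T"

definition PT_B :: "nat \<Rightarrow> tableau set" where
  "PT_B n = {T. fst T \<subseteq> {1..int n} \<and> snd T \<subseteq> cells n (fst T)
     \<and> (\<forall>c \<in> fst T. \<exists>r. (r, c) \<in> snd T)
     \<and> (\<forall>r c. zero_at n T r c \<longrightarrow> \<not> (one_above T r c \<and> one_left T r c))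
     \<and> (\<forall>c. zero_at n T (- c) c \<longrightarrow> \<not> one_left T (- c) c)}"

definition restricted_zero :: "nat \<Rightarrow> tableau \<Rightarrow> int \<Rightarrow> int \<Rightarrow> bool" where
  "restricted_zero n T r c \<longleftrightarrow> zero_at n T r c \<and> (one_above T r c \<or> r = - c)"

definition unrestricted_rows :: "nat \<Rightarrow> tableau \<Rightarrow> int set" where
  "unrestricted_rows n T = {r \<in> row_labels n (fst T). \<forall>c. \<not> restricted_zero n T r c}"

definition rightmost_restricted_zero :: "nat \<Rightarrow> tableau \<Rightarrow> int \<Rightarrow> int \<Rightarrow> bool" where
  "rightmost_restricted_zero n T r c \<longleftrightarrow>
     restricted_zero n T r c \<and> (\<forall>c' < c. \<not> restricted_zero n T r c')"

definition urr :: "nat \<Rightarrow> tableau \<Rightarrow> nat" where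
  "urr n T = card (unrestricted_rows n T)"

definition diag :: "tableau \<Rightarrow> nat" where
  "diag T = card {c \<in> fst T. (- c, c) \<in> snd T}"

definition topmost_unrestricted_row :: "nat \<Rightarrow> tableau \<Rightarrow> int" where
  "topmost_unrestricted_row n T = Min (unrestricted_rows n T)"

definition top01 :: "nat \<Rightarrow> tableau \<Rightarrow> nat" where
  "top01 n T = (let m = topmost_unrestricted_row n T in
     card {c. (m, c) \<in> snd T \<and> m \<noteq> - c}
     + (if \<bar>m\<bar> \<in> fst T then card {r. rightmost_restricted_zero n T r \<bar>m\<bar>} else 0))"

lemma finite_cells:
  assumes "C \<subseteq> {1..int n}"
  shows "finite (cells n C)"
proof (rule finite_subset)
  show "cells n C \<subseteq> {- int n..int n} \<times> {1..int n}"
    using assms by (fastforce simp: cells_def)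
qed simp

lemma finite_PT_B: "finite (PT_B n)"
proof (rule finite_subset)
  show "PT_B n \<subseteq> (SIGMA C : Pow {1..int n}. Pow (cells n C))"
    by (auto simp: PT_B_def)
  show "finite (SIGMA C : Pow {1..int n}. Pow (cells n C))"
    by (rule finite_SigmaI) (simp_all add: finite_cells)
qed

lemma finite_unrestricted_rows:
  assumes "T \<in> PT_B n"
  shows "finite (unrestricted_rows n T)"
proof -
  have "finite (fst T)"
    using assms by (auto simp: PT_B_def intro: finite_subset)
  then have "finite (row_labels n (fst T))"
    by (simp add: row_labels_def)
  then show ?thesis
    by (rule rev_finite_subset) (auto simp: unrestricted_rows_def)
qed

text \<open>
  For \<open>n \<ge> 1\<close> there is always an unrestricted row: the row of any 1 in the leftmost column. So the
  \<open>Min\<close> above is a genuine minimum, and the truncated subtraction in \<open>urr n T - 1\<close> is harmless.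
\<close>

lemma unrestricted_rows_nonempty:
  assumes T: "T \<in> PT_B n" and n: "n \<ge> 1"
  shows "unrestricted_rows n T \<noteq> {}"
proof (cases "fst T = {}")
  case True
  then have "1 \<in> unrestricted_rows n T"
    using n by (auto simp: unrestricted_rows_def row_labels_def restricted_zero_def
        zero_at_def cells_def)
  then show ?thesis by auto
next
  case False
  have sub: "fst T \<subseteq> {1..int n}" using T by (auto simp: PT_B_def)
  then have fin: "finite (fst T)" by (rule finite_subset) simp
  define c where "c = Max (fst T)"
  have c: "c \<in> fst T" and cmax: "\<And>d. d \<in> fst T \<Longrightarrow> d \<le> c"
    using fin False by (auto simp: c_def)
  obtain r where r: "(r, c) \<in> snd T" using T c by (auto simp: PT_B_def)
  then have rc: "(r, c) \<in> cells n (fst T)" using T by (auto simp: PT_B_def)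
  have "\<not> restricted_zero n T r d" for d
  proof
    assume d: "restricted_zero n T r d"
    then have z: "zero_at n T r d" by (simp add: restricted_zero_def)
    then have "d \<in> fst T" "d \<noteq> c" using r by (auto simp: zero_at_def cells_def)
    then have "one_left T r d" using cmax[of d] r by (force simp: one_left_def)
    then show False using T d z by (auto simp: PT_B_def restricted_zero_def)
  qed
  moreover have "r \<in> row_labels n (fst T)" using rc by (auto simp: cells_def row_labels_def)
  ultimately show ?thesis by (auto simp: unrestricted_rows_def)
qed

end

theory Submission
  imports Defs
begin

text \<open>
  Adding the label \<open>N = n + 1\<close> to a tableau \<open>T\<close> of length \<open>n\<close> gives either an empty bottom row or a
  new leftmost column together with a new top row \<open>- N\<close> consisting of one diagonal cell. By
  conditions (2) and (3) the new column can have 1's exactly in row \<open>- N\<close> and in unrestricted rows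
  of \<open>T\<close>, so the tableaux of length \<open>N\<close> correspond to the pairs of a tableau \<open>T\<close> and a set \<open>S\<close> of
  such rows, where \<open>S = {}\<close> encodes the empty bottom row.

  If \<open>- N \<in> S\<close>, then \<open>- N\<close> is the topmost unrestricted row, the unrestricted rows are those in \<open>S\<close>,
  and the rows of \<open>T\<close> that become restricted have their rightmost restricted 0 in column \<open>N\<close>.
  Otherwise the topmost unrestricted row \<open>m\<close> is the one of \<open>T\<close>, and \<open>top\<^sub>0\<^sub>,\<^sub>1\<close> grows by one iff
  \<open>m \<in> S\<close>. Summing over \<open>S\<close> gives, for the generating functions \<open>G\<^sub>n\<close>,
  \<open>G\<^sub>N(x, y) = (x + y) G\<^sub>n(1 + x, y) + z (x + y) G\<^sub>n(x + y, 1)\<close>, and both terms on the right are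
  multiples of the rising factorial of \<open>x + y + 1\<close> by induction.
\<close>

section \<open>Sums over the subsets of a finite set\<close>

lemma sum_Pow_insert:
  fixes g :: "'b set \<Rightarrow> 'a :: comm_monoid_add"
  assumes "finite A" "a \<notin> A"
  shows "(\<Sum>S \<in> Pow (insert a A). g S) = (\<Sum>S \<in> Pow A. g S) + (\<Sum>S \<in> Pow A. g (insert a S))"
proof -
  have "inj_on (insert a) (Pow A)"
    using assms(2) by (auto simp: inj_on_def)
  then have "sum g (insert a ` Pow A) = (\<Sum>S \<in> Pow A. g (insert a S))"
    by (simp add: sum.reindex)
  moreover have "Pow A \<inter> insert a ` Pow A = {}"
    using assms(2) by auto
  ultimately show ?thesis
    using assms(1) by (simp add: Pow_insert sum.union_disjoint)
qed

text \<open>Expanding the product of one factor \<open>x + y\<close> per element of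
  \<open>A\<close>: elements of \<open>S\<close> choose \<open>x\<close>, the others
  \<open>y\<close>.\<close>

lemma sum_Pow_binomial:
  fixes x y :: "'a :: comm_semiring_1"
  assumes "finite A"
  shows "(\<Sum>S \<in> Pow A. x ^ card S * y ^ card (A - S)) = (x + y) ^ card A"
  using assms
proof (induction A rule: finite_induct)
  case empty
  then show ?case by simp
next
  case (insert a A)
  have 1: "card (insert a A - S) = Suc (card (A - S))" if "S \<in> Pow A" for S
    using that insert.hyps by (subst insert_Diff_if) auto
  have 2: "card (insert a S) = Suc (card S)" "insert a A - insert a S = A - S" if "S \<in> Pow A" for S
    using that insert.hyps finite_subset[of S A] by (auto intro!: card_insert_disjoint)
  have "(\<Sum>S \<in> Pow (insert a A). x ^ card S * y ^ card (insert a A - S))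
    = (\<Sum>S \<in> Pow A. y * (x ^ card S * y ^ card (A - S)))
      + (\<Sum>S \<in> Pow A. x * (x ^ card S * y ^ card (A - S)))"
    using insert.hyps by (simp add: sum_Pow_insert 1 2 mult_ac)
  also have "\<dots> = (x + y) * (x + y) ^ card A"
    by (simp add: sum_distrib_left[symmetric] insert.IH distrib_right add.commute)
  finally show ?case using insert.hyps by simp
qed

text \<open>
  The rows in \<open>A\<close> that stay unrestricted when a new leftmost column has its 1's in the rows in \<open>S\<close>:
  a 0 of that column is unrestricted iff it lies above all 1's.
\<close>

definition kept :: "'b :: linorder set \<Rightarrow> 'b set \<Rightarrow> 'b set" where
  "kept A S = {r \<in> A. r \<in> S \<or> (\<forall>s \<in> S. r < s)}"

text \<open>A new minimum \<open>a\<close> lies below all of \<open>S\<close>, so it survives even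
  outside \<open>S\<close>. Once \<open>a\<close> is in the chosen set, no other element lies below
  all chosen ones, and only these survive.\<close>

lemma kept_insert_min:
  assumes "\<And>r. r \<in> A \<Longrightarrow> a < r" "S \<subseteq> A"
  shows "kept (insert a A) S = insert a (kept A S)"
    and "kept (insert a A) (insert a S) = insert a S"
  using assms by (auto simp: kept_def dest: less_asym)

lemma finite_kept: "finite A \<Longrightarrow> finite (kept A S)"
  by (simp add: kept_def)

text \<open>The additional exponent for \<open>S = {}\<close> counts the empty bottom row that is
  then added, which is unrestricted. Adding a new minimum to \<open>A\<close> splits the sum into
  subsets without it, which gain a factor \<open>x\<close>, and subsets with it, which form a
  binomial sum.\<close>

lemma sum_Pow_kept:
  fixes x :: "'a :: comm_semiring_1" and A :: "'b :: linorder set"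
  assumes "finite A"
  shows "(\<Sum>S \<in> Pow A. x ^ (card (kept A S) + (if S = {} then 1 else 0))) = x * (1 + x) ^ card A"
  using assms
proof (induction A rule: finite_linorder_min_induct)
  case empty
  then show ?case by (simp add: kept_def)
next
  case (insert a A)
  have a: "a \<notin> A" using insert.hyps by auto
  then have 1: "card (insert a (kept A S)) = Suc (card (kept A S))" for S
    using insert.hyps by (subst card_insert_disjoint) (auto simp: kept_def)
  have 2: "card (insert a S) = Suc (card S)" if "S \<in> Pow A" for S
    using that a insert.hyps finite_subset[of S A] by (auto intro!: card_insert_disjoint)
  have "(\<Sum>S \<in> Pow (insert a A). x ^ (card (kept (insert a A) S) + (if S = {} then 1 else 0)))
    = (\<Sum>S \<in> Pow A. x * x ^ (card (kept A S) + (if S = {} then 1 else 0)))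
      + (\<Sum>S \<in> Pow A. x * (x ^ card S * 1 ^ card (A - S)))"
    using insert.hyps a by (simp add: sum_Pow_insert kept_insert_min 1 2)
  also have "\<dots> = x * (x * (1 + x) ^ card A) + x * (x + 1) ^ card A"
    unfolding sum_distrib_left[symmetric] sum_Pow_binomial[OF insert.hyps(1)] insert.IH ..
  also have "\<dots> = x * (1 + x) ^ Suc (card A)"
    by (simp add: algebra_simps)
  finally show ?case using insert.hyps a by simp
qed

section \<open>Cells, zeros and unrestricted rows after adding a label\<close>

text \<open>
  For \<open>S = {}\<close> the pair \<open>T\<close> is unchanged and is only read as a tableau of length \<open>n + 1\<close>, whose
  label \<open>n + 1\<close> is an empty row.
\<close>

definition extend :: "nat \<Rightarrow> tableau \<Rightarrow> int set \<Rightarrow> tableau" where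
  "extend n T S = (if S = {} then fst T else insert (1 + int n) (fst T), snd T \<union> S \<times> {1 + int n})"

definition extension_rows :: "nat \<Rightarrow> tableau \<Rightarrow> int set" where
  "extension_rows n T = insert (- (1 + int n)) (unrestricted_rows n T)"

lemma in_ones_extend:
  "(r, c) \<in> snd (extend n T S) \<longleftrightarrow> (r, c) \<in> snd T \<or> c = 1 + int n \<and> r \<in> S"
  by (auto simp: extend_def)

lemma PT_B_subsets:
  assumes "T \<in> PT_B n"
  shows "fst T \<subseteq> {1..int n}" "snd T \<subseteq> cells n (fst T)"
  using assms by (auto simp: PT_B_def)

lemma unrestricted_rows_bounds:
  assumes "fst T \<subseteq> {1..int n}" "r \<in> unrestricted_rows n T"
  shows "- int n \<le> r" "r \<le> int n"
  using assms by (force simp: unrestricted_rows_def row_labels_def)+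

lemma new_not_cell:
  assumes "C \<subseteq> {1..int n}"
  shows "(r, 1 + int n) \<notin> cells n C" "(- (1 + int n), c) \<notin> cells n C"
  using assms by (force simp: cells_def)+

lemma new_not_one:
  assumes "fst T \<subseteq> {1..int n}" "snd T \<subseteq> cells n (fst T)"
  shows "(r, 1 + int n) \<notin> snd T" "(- (1 + int n), c) \<notin> snd T"
  using assms new_not_cell by blast+

lemma zero_at_bound:
  assumes "fst T \<subseteq> {1..int n}" "zero_at n T r c"
  shows "c < 1 + int n"
  using assms by (force simp: zero_at_def cells_def)

lemma in_cells_iff:
  "(r, c) \<in> cells n C \<longleftrightarrow> c \<in> C \<and> (1 \<le> r \<and> r \<le> int n \<and> r \<notin> C \<and> r < c \<or> - r \<in> C \<and> - r \<le> c)"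
proof -
  have "(\<exists>j c'. (r, c) = (- j, c') \<and> j \<in> C \<and> c' \<in> C \<and> j \<le> c') \<longleftrightarrow> - r \<in> C \<and> c \<in> C \<and> - r \<le> c"
    by (metis minus_minus prod.inject)
  then show ?thesis
    unfolding cells_def Un_iff mem_Collect_eq prod.case by auto
qed

lemma in_row_labels_iff: "r \<in> row_labels n C \<longleftrightarrow> 1 \<le> r \<and> r \<le> int n \<and> r \<notin> C \<or> - r \<in> C"
  unfolding row_labels_def by (metis Diff_iff Un_iff atLeastAtMost_iff image_iff minus_minus)

lemma cells_Suc:
  assumes "C \<subseteq> {1..int n}"
  shows "cells (Suc n) C = cells n C"
proof -
  have "r \<le> int n" "r \<le> 1 + int n" if "c \<in> C" "r < c" for r c
    using that assms by fastforce+
  then have "(r, c) \<in> cells (Suc n) C \<longleftrightarrow> (r, c) \<in> cells n C" for r c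
    unfolding in_cells_iff by auto
  then show ?thesis by auto
qed

text \<open>The new column is leftmost, so every row acquires a cell in it, and the new row consists
  of its diagonal cell alone.\<close>

lemma cells_Suc_insert:
  assumes "C \<subseteq> {1..int n}"
  shows "cells (Suc n) (insert (1 + int n) C)
    = cells n C \<union> insert (- (1 + int n)) (row_labels n C) \<times> {1 + int n}"
proof -
  let ?N = "1 + int n"
  have le: "c < ?N" "- c < ?N" if "c \<in> C" for c
    using that assms by fastforce+
  have "(r, c) \<in> cells (Suc n) (insert ?N C) \<longleftrightarrow>
      (r, c) \<in> cells n C \<or> r \<in> insert (- ?N) (row_labels n C) \<and> c = ?N" for r c
  proof (cases "c = ?N")
    case True
    then have "(r, c) \<notin> cells n C" using le(1)[of ?N] by (auto simp: in_cells_iff)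
    moreover have "- r \<le> ?N" if "- r \<in> C" using le(1)[OF that] by simp
    ultimately show ?thesis
      using True by (auto simp: in_cells_iff in_row_labels_iff)
  next
    case False
    then show ?thesis
      using le(1)[of c] by (auto simp: in_cells_iff)
  qed
  then show ?thesis by auto
qed

lemma row_labels_Suc:
  assumes "C \<subseteq> {1..int n}"
  shows "row_labels (Suc n) C = insert (1 + int n) (row_labels n C)"
    and "row_labels (Suc n) (insert (1 + int n) C) = insert (- (1 + int n)) (row_labels n C)"
proof -
  have "1 + int n \<notin> C" "- (1 + int n) \<notin> C"
    using assms by auto
  then show "row_labels (Suc n) C = insert (1 + int n) (row_labels n C)"
    "row_labels (Suc n) (insert (1 + int n) C) = insert (- (1 + int n)) (row_labels n C)"
    by (auto simp: row_labels_def)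
qed

context
  fixes n :: nat and T :: tableau and S :: "int set"
  assumes T: "fst T \<subseteq> {1..int n}" "snd T \<subseteq> cells n (fst T)"
    and S: "S \<subseteq> insert (- (1 + int n)) (row_labels n (fst T))"
begin

lemma in_cells_extend:
  "(r, c) \<in> cells (Suc n) (fst (extend n T S)) \<longleftrightarrow> (r, c) \<in> cells n (fst T) \<or>
    c = 1 + int n \<and> S \<noteq> {} \<and> r \<in> insert (- (1 + int n)) (row_labels n (fst T))"
  using T(1) by (auto simp: extend_def cells_Suc cells_Suc_insert)

lemma one_above_extend:
  "one_above (extend n T S) r c \<longleftrightarrow> one_above T r c \<or> c = 1 + int n \<and> (\<exists>s \<in> S. s < r)"
  by (auto simp: one_above_def in_ones_extend)

lemma one_left_extend:
  "one_left (extend n T S) r c \<longleftrightarrow> one_left T r c \<or> c < 1 + int n \<and> r \<in> S"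
  by (auto simp: one_left_def in_ones_extend)

lemma zero_at_extend:
  "zero_at (Suc n) (extend n T S) r c \<longleftrightarrow> zero_at n T r c \<or>
    c = 1 + int n \<and> S \<noteq> {} \<and> r \<in> insert (- (1 + int n)) (row_labels n (fst T)) - S"
  using new_not_cell[OF T(1)] new_not_one[OF T]
  by (auto simp: zero_at_def in_cells_extend in_ones_extend)

text \<open>Old zeros keep their status because the new 1's all lie in the new column. A 0 of the
  new column is restricted iff it is the diagonal one or lies below a row of
  \<open>S\<close>.\<close>

lemma restricted_zero_extend:
  "restricted_zero (Suc n) (extend n T S) r c \<longleftrightarrow> restricted_zero n T r c \<or>
    c = 1 + int n \<and> S \<noteq> {} \<and> r \<in> insert (- (1 + int n)) (row_labels n (fst T)) - S \<and>
    (r = - (1 + int n) \<or> (\<exists>s \<in> S. s < r))"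
  using new_not_one(1)[OF T]
  unfolding restricted_zero_def zero_at_extend one_above_extend
  by (auto simp: one_above_def dest: zero_at_bound[OF T(1)])

lemma unrestricted_rows_extend:
  assumes S': "S \<subseteq> extension_rows n T"
  shows "unrestricted_rows (Suc n) (extend n T S) =
    (if S = {} then insert (1 + int n) (unrestricted_rows n T)
     else if - (1 + int n) \<in> S then S
     else kept (unrestricted_rows n T) S)"
proof -
  have rows: "row_labels (Suc n) (fst (extend n T S)) =
    insert (if S = {} then 1 + int n else - (1 + int n)) (row_labels n (fst T))"
    using T(1) by (simp add: extend_def row_labels_Suc)
  have new: "\<not> restricted_zero n T (1 + int n) c" "\<not> restricted_zero n T (- (1 + int n)) c" for c
    using T(1) by (auto simp: restricted_zero_def zero_at_def in_cells_iff)
  have bound: "- (1 + int n) < r" if "r \<in> row_labels n (fst T)" for r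
    using that T(1) by (auto simp: in_row_labels_iff dest: subsetD)
  consider "S = {}" | "- (1 + int n) \<in> S" | "S \<noteq> {}" "- (1 + int n) \<notin> S" by blast
  then show ?thesis
  proof cases
    case 1
    then show ?thesis
      using new unfolding unrestricted_rows_def rows restricted_zero_extend by auto
  next
    case 2
    have "r \<in> unrestricted_rows (Suc n) (extend n T S) \<longleftrightarrow> r \<in> S" for r
    proof
      assume r: "r \<in> unrestricted_rows (Suc n) (extend n T S)"
      show "r \<in> S"
      proof (rule ccontr)
        assume "r \<notin> S"
        moreover from this have "r \<in> row_labels n (fst T)"
          using r 2 by (auto simp: unrestricted_rows_def rows split: if_splits)
        ultimately have "restricted_zero (Suc n) (extend n T S) r (1 + int n)"
          using 2 bound by (auto simp: restricted_zero_extend)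
        then show False using r by (auto simp: unrestricted_rows_def)
      qed
    next
      assume "r \<in> S"
      then show "r \<in> unrestricted_rows (Suc n) (extend n T S)"
        using S' new by (auto simp: unrestricted_rows_def rows restricted_zero_extend extension_rows_def)
    qed
    then show ?thesis using 2 by auto
  next
    case 3
    have "r \<in> unrestricted_rows (Suc n) (extend n T S) \<longleftrightarrow> r \<in> kept (unrestricted_rows n T) S" for r
    proof
      assume r: "r \<in> unrestricted_rows (Suc n) (extend n T S)"
      \<comment> \<open>The diagonal cell of the new column holds a 0, which is restricted by
        definition, so the new top row drops out.\<close>
      have "\<not> restricted_zero (Suc n) (extend n T S) (- (1 + int n)) (1 + int n) \<Longrightarrow> False"
        using 3 by (simp add: restricted_zero_extend)
      then have "r \<noteq> - (1 + int n)" using r by (auto simp: unrestricted_rows_def)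
      then have "r \<in> row_labels n (fst T)" "\<And>c. \<not> restricted_zero (Suc n) (extend n T S) r c"
        using r 3 by (auto simp: unrestricted_rows_def rows)
      then show "r \<in> kept (unrestricted_rows n T) S"
        using 3 by (force simp: unrestricted_rows_def kept_def restricted_zero_extend)
    next
      assume "r \<in> kept (unrestricted_rows n T) S"
      then show "r \<in> unrestricted_rows (Suc n) (extend n T S)"
        using 3 bound
        by (force simp: unrestricted_rows_def kept_def rows restricted_zero_extend)
    qed
    then show ?thesis using 3 by auto
  qed
qed

text \<open>A 1 of the new column lies to the left of every old cell in its row. Conditions (2) and
  (3) therefore forbid exactly the restricted zeros in rows of \<open>S\<close>. Here
  \<open>T\<close> is any 0,1-filling of a diagram, so the equivalence also recovers the validity of
  \<open>T\<close> from that of its extension.\<close>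

lemma extend_in_PT_B_iff:
  "extend n T S \<in> PT_B (Suc n) \<longleftrightarrow> T \<in> PT_B n \<and> S \<subseteq> extension_rows n T"
proof -
  let ?T = "extend n T S"
  have fst: "fst ?T \<subseteq> {1..int (Suc n)}"
    using subset_trans[OF T(1), of "{1..int (Suc n)}"] by (simp add: extend_def)
  have snd: "snd ?T \<subseteq> cells (Suc n) (fst ?T)"
  proof
    fix p assume "p \<in> snd ?T"
    then show "p \<in> cells (Suc n) (fst ?T)"
      using T(2) S by (cases p) (auto simp only: in_cells_extend in_ones_extend)
  qed
  have "1 + int n \<notin> fst T" using T(1) by auto
  then have col: "(\<forall>c \<in> fst ?T. \<exists>r. (r, c) \<in> snd ?T) \<longleftrightarrow> (\<forall>c \<in> fst T. \<exists>r. (r, c) \<in> snd T)"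
    unfolding in_ones_extend by (auto simp: extend_def)
  \<comment> \<open>With nothing to their left, the zeros of the new column can violate neither (2)
    nor (3).\<close>
  have left: "\<not> one_left T r (1 + int n)" for r
  proof -
    have "c \<le> int n" if "(r, c) \<in> snd T" for c
      using subsetD[OF T(2) that] T(1) by (auto simp: in_cells_iff)
    then show ?thesis by (force simp: one_left_def)
  qed
  have new: "\<not> restricted_zero n T (- (1 + int n)) c" for c
    using T(1) by (auto simp: restricted_zero_def zero_at_def in_cells_iff)
  have ext: "S \<subseteq> extension_rows n T \<longleftrightarrow> (\<forall>r \<in> S. \<forall>c. \<not> restricted_zero n T r c)"
    using S new by (auto simp: extension_rows_def unrestricted_rows_def)
  have zero: "(\<forall>r c. zero_at (Suc n) ?T r c \<longrightarrow> \<not> (one_above ?T r c \<and> one_left ?T r c)) \<longleftrightarrow>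
    (\<forall>r c. zero_at n T r c \<longrightarrow> \<not> (one_above T r c \<and> (one_left T r c \<or> r \<in> S)))"
    unfolding zero_at_extend one_above_extend one_left_extend
    using left zero_at_bound[OF T(1)] by (metis less_irrefl)
  have diag: "(\<forall>c. zero_at (Suc n) ?T (- c) c \<longrightarrow> \<not> one_left ?T (- c) c) \<longleftrightarrow>
    (\<forall>c. zero_at n T (- c) c \<longrightarrow> \<not> (one_left T (- c) c \<or> - c \<in> S))"
    unfolding zero_at_extend one_left_extend
    using left zero_at_bound[OF T(1)] by (metis less_irrefl)
  show ?thesis
    unfolding PT_B_def mem_Collect_eq col zero diag ext restricted_zero_def
    using T fst snd by blast
qed

end

section \<open>The bijection between pairs and tableaux of the next length\<close>

lemma extension_rows_subset:
  "extension_rows n T \<subseteq> insert (- (1 + int n)) (row_labels n (fst T))"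
  by (auto simp: extension_rows_def unrestricted_rows_def)

text \<open>The preimage arises by deleting column \<open>N\<close>, if there is one, and recording
  in \<open>S\<close> the rows of its 1's.\<close>

lemma extend_surj:
  assumes T': "T' \<in> PT_B (Suc n)"
  obtains T S where "T \<in> PT_B n" "S \<subseteq> extension_rows n T" "T' = extend n T S"
proof -
  define N where "N = 1 + int n"
  define T where "T = (fst T' - {N}, {(r, c) \<in> snd T'. c \<noteq> N})"
  define S where "S = {r. (r, N) \<in> snd T'}"
  have sub: "fst T' \<subseteq> {1..N}" and ones: "snd T' \<subseteq> cells (Suc n) (fst T')"
    and col: "\<And>c. c \<in> fst T' \<Longrightarrow> \<exists>r. (r, c) \<in> snd T'"
    using T' by (auto simp: PT_B_def N_def)
  have 1: "fst T \<subseteq> {1..int n}"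
    using sub by (force simp: T_def N_def)
  have "cells (Suc n) (fst T') \<subseteq> cells n (fst T) \<union> insert (- N) (row_labels n (fst T)) \<times> {N}"
  proof (cases "N \<in> fst T'")
    case True
    then have "fst T' = insert N (fst T)" by (auto simp: T_def)
    then show ?thesis using 1 by (simp add: N_def cells_Suc_insert)
  next
    case False
    then have "fst T' = fst T" by (auto simp: T_def)
    then show ?thesis using 1 by (auto simp: cells_Suc)
  qed
  then have 2: "snd T' \<subseteq> cells n (fst T) \<union> insert (- N) (row_labels n (fst T)) \<times> {N}"
    using ones by blast
  then have 3: "snd T \<subseteq> cells n (fst T)" "S \<subseteq> insert (- N) (row_labels n (fst T))"
    using new_not_cell(1)[OF 1] by (auto simp: T_def S_def N_def)
  \<comment> \<open>By condition (1) a column \<open>N\<close> contains a 1, so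
    \<open>S = {}\<close> only if \<open>N\<close> labels a row.\<close>
  have "N \<in> fst T' \<longleftrightarrow> S \<noteq> {}"
  proof
    assume "S \<noteq> {}"
    then show "N \<in> fst T'" using ones by (auto simp: S_def cells_def)
  next
    assume "N \<in> fst T'"
    then show "S \<noteq> {}" using col by (auto simp: S_def)
  qed
  then have "T' = extend n T S"
    by (auto simp: extend_def T_def S_def N_def prod_eq_iff)
  moreover have "T \<in> PT_B n" "S \<subseteq> extension_rows n T"
    using extend_in_PT_B_iff[OF 1 3(1) 3(2)[unfolded N_def]] T' calculation by auto
  ultimately show thesis using that by blast
qed

lemma bij_betw_extend:
  "bij_betw (\<lambda>(T, S). extend n T S) (SIGMA T : PT_B n. Pow (extension_rows n T)) (PT_B (Suc n))"
proof (rule bij_betw_imageI)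
  show "inj_on (\<lambda>(T, S). extend n T S) (SIGMA T : PT_B n. Pow (extension_rows n T))"
  proof (rule inj_onI, clarify)
    fix C1 f1 S1 C2 f2 S2
    assume T: "(C1, f1) \<in> PT_B n" "(C2, f2) \<in> PT_B n"
      and eq: "extend n (C1, f1) S1 = extend n (C2, f2) S2"
    note sub = PT_B_subsets[OF T(1)] PT_B_subsets[OF T(2)]
    have C: "1 + int n \<notin> C1" "1 + int n \<notin> C2"
      using sub(1,3) by auto
    have f: "(r, 1 + int n) \<notin> f1" "(r, 1 + int n) \<notin> f2" for r
      using new_not_one(1)[OF sub(1,2)] new_not_one(1)[OF sub(3,4)] by auto
    have ff: "(r, c) \<in> f1 \<or> c = 1 + int n \<and> r \<in> S1 \<longleftrightarrow>
        (r, c) \<in> f2 \<or> c = 1 + int n \<and> r \<in> S2" for r c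
      using in_ones_extend[of r c n "(C1, f1)" S1] in_ones_extend[of r c n "(C2, f2)" S2] eq by simp
    \<comment> \<open>Neither old filling has a 1 in the new column, so that column determines the
      set.\<close>
    have S: "S1 = S2" using f ff[of _ "1 + int n"] by blast
    moreover have "f1 = f2"
    proof (rule set_eqI, clarify)
      show "(r, c) \<in> f1 \<longleftrightarrow> (r, c) \<in> f2" for r c using f ff[of r c] by blast
    qed
    moreover have "C1 = C2"
    proof (cases "S1 = {}")
      case True
      then show ?thesis using eq S by (simp add: extend_def)
    next
      case False
      then have "insert (1 + int n) C1 = insert (1 + int n) C2"
        using eq S by (simp add: extend_def)
      then show ?thesis using C by (simp add: insert_ident)
    qed
    ultimately show "(C1, f1) = (C2, f2) \<and> S1 = S2" by simp
  qed
  show "(\<lambda>(T, S). extend n T S) ` (SIGMA T : PT_B n. Pow (extension_rows n T)) = PT_B (Suc n)"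
  proof (intro equalityI subsetI)
    fix T' assume "T' \<in> (\<lambda>(T, S). extend n T S) ` (SIGMA T : PT_B n. Pow (extension_rows n T))"
    then obtain T S where T: "T \<in> PT_B n" "S \<subseteq> extension_rows n T" "T' = extend n T S" by auto
    then show "T' \<in> PT_B (Suc n)"
      using extend_in_PT_B_iff[OF PT_B_subsets[OF T(1)] subset_trans[OF T(2) extension_rows_subset]]
      by simp
  next
    fix T' assume "T' \<in> PT_B (Suc n)"
    then obtain T S where "T \<in> PT_B n" "S \<subseteq> extension_rows n T" "T' = extend n T S"
      by (rule extend_surj)
    then show "T' \<in> (\<lambda>(T, S). extend n T S) ` (SIGMA T : PT_B n. Pow (extension_rows n T))"
      by (intro image_eqI[of _ _ "(T, S)"]) simp_all
  qed
qed

section \<open>The statistics of an extended tableau\<close>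

context
  fixes n :: nat and T :: tableau and S :: "int set"
  assumes TP: "T \<in> PT_B n" and SP: "S \<subseteq> extension_rows n T"
begin

lemmas subsetsP = PT_B_subsets[OF TP] subset_trans[OF SP extension_rows_subset]

lemma diag_extend: "diag (extend n T S) = diag T + (if - (1 + int n) \<in> S then 1 else 0)"
proof -
  let ?N = "1 + int n" and ?D = "{c \<in> fst T. (- c, c) \<in> snd T}"
  have fin: "finite ?D"
    using subsetsP(1) by (auto intro: finite_subset)
  have N: "?N \<notin> ?D" using subsetsP(1) by force
  have "{c \<in> fst (extend n T S). (- c, c) \<in> snd (extend n T S)} =
      (if - ?N \<in> S then insert ?N ?D else ?D)"
    using N subsetsP(1) new_not_one[OF subsetsP(1,2)] by (auto simp: extend_def)
  then show ?thesis using fin N by (simp add: diag_def)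
qed

text \<open>The topmost row has only its diagonal 1, which is not counted. As column
  \<open>N\<close> is leftmost, a restricted 0 in it is the rightmost of its row iff that row was
  unrestricted in \<open>T\<close>, and the 1 on top makes every 0 below it restricted.\<close>

lemma top01_extend_diagonal:
  assumes "- (1 + int n) \<in> S"
  shows "top01 (Suc n) (extend n T S) = card (unrestricted_rows n T - S)"
proof -
  let ?N = "1 + int n"
  have fin: "finite S"
    using SP finite_unrestricted_rows[OF TP] by (auto simp: extension_rows_def intro: finite_subset)
  have "- ?N \<le> r" if "r \<in> S" for r
    using that SP unrestricted_rows_bounds(1)[OF subsetsP(1), of r] by (auto simp: extension_rows_def)
  then have "Min S = - ?N"
    using assms fin by (auto intro: Min_eqI)
  then have top: "topmost_unrestricted_row (Suc n) (extend n T S) = - ?N"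
    using assms
    by (auto simp: topmost_unrestricted_row_def unrestricted_rows_extend[OF subsetsP SP])
  have "{c. (- ?N, c) \<in> snd (extend n T S) \<and> - ?N \<noteq> - c} = {}"
    using new_not_one(2)[OF subsetsP(1,2)] by (auto simp: in_ones_extend)
  moreover have "?N \<in> fst (extend n T S)"
    using assms by (auto simp: extend_def)
  moreover have "{r. rightmost_restricted_zero (Suc n) (extend n T S) r ?N} =
      unrestricted_rows n T - S" (is "?L = ?R")
  proof (intro equalityI subsetI)
    fix r assume "r \<in> ?L"
    then have 1: "restricted_zero (Suc n) (extend n T S) r ?N"
      and 2: "\<And>c. c < ?N \<Longrightarrow> \<not> restricted_zero (Suc n) (extend n T S) r c"
      by (auto simp: rightmost_restricted_zero_def)
    have no: "\<not> restricted_zero n T r c" for c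
      using 2[of c] zero_at_bound[OF subsetsP(1), of r c]
      unfolding restricted_zero_extend[OF subsetsP] by (auto simp: restricted_zero_def)
    then show "r \<in> ?R"
      using 1 assms by (auto simp: restricted_zero_extend[OF subsetsP] unrestricted_rows_def)
  next
    fix r assume r: "r \<in> ?R"
    then have "- ?N < r"
      using unrestricted_rows_bounds(1)[OF subsetsP(1), of r] by auto
    then show "r \<in> ?L"
      using r assms
      by (auto simp: rightmost_restricted_zero_def restricted_zero_extend[OF subsetsP] unrestricted_rows_def)
  qed
  moreover have "\<bar>- ?N\<bar> = ?N" by simp
  ultimately show ?thesis unfolding top01_def top Let_def by (simp only: card.empty if_True add_0)
qed

text \<open>The old topmost row is either in \<open>S\<close> or above all of \<open>S\<close>, so
  it stays unrestricted; for \<open>S = {}\<close> the added row is at the bottom. The bound on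
  \<open>n\<close> guarantees that an old unrestricted row exists.\<close>

lemma topmost_unrestricted_row_extend:
  assumes "- (1 + int n) \<notin> S" "n \<ge> 1"
  shows "topmost_unrestricted_row (Suc n) (extend n T S) = topmost_unrestricted_row n T"
proof -
  let ?U = "unrestricted_rows n T"
  have fin: "finite ?U" and ne: "?U \<noteq> {}"
    using finite_unrestricted_rows[OF TP] unrestricted_rows_nonempty[OF TP assms(2)] by auto
  have SU: "S \<subseteq> ?U" using SP assms by (auto simp: extension_rows_def)
  have m: "Min ?U \<in> ?U" "\<And>r. r \<in> ?U \<Longrightarrow> Min ?U \<le> r" using fin ne by auto
  have "Min (insert (1 + int n) ?U) = Min ?U"
    using fin ne m unrestricted_rows_bounds(2)[OF subsetsP(1), of "Min ?U"] by simp
  moreover have "Min (kept ?U S) = Min ?U"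
  proof (rule Min_eqI)
    show "finite (kept ?U S)" using fin by (rule finite_kept)
    show "Min ?U \<in> kept ?U S" using m SU by (auto simp: kept_def less_le)
    show "Min ?U \<le> r" if "r \<in> kept ?U S" for r using that m by (auto simp: kept_def)
  qed
  ultimately show ?thesis
    using assms by (simp add: topmost_unrestricted_row_def unrestricted_rows_extend[OF subsetsP SP])
qed

text \<open>Since \<open>\<bar>m\<bar> \<le> n\<close> for the topmost row \<open>m\<close>, a new 1
  in that row is not diagonal, and column \<open>\<bar>m\<bar>\<close> lies to the right of the new
  one, so its rightmost restricted zeros are unchanged.\<close>

lemma top01_extend:
  assumes "- (1 + int n) \<notin> S" "n \<ge> 1"
  shows "top01 (Suc n) (extend n T S)
    = top01 n T + (if topmost_unrestricted_row n T \<in> S then 1 else 0)"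
proof -
  let ?N = "1 + int n" and ?m = "topmost_unrestricted_row n T"
  let ?O = "{c. (?m, c) \<in> snd T \<and> ?m \<noteq> - c}"
  have "?m \<in> unrestricted_rows n T"
    using finite_unrestricted_rows[OF TP] unrestricted_rows_nonempty[OF TP assms(2)]
    by (simp add: topmost_unrestricted_row_def)
  then have m: "\<bar>?m\<bar> < ?N"
    using unrestricted_rows_bounds[OF subsetsP(1), of ?m] by auto
  have "?O \<subseteq> {1..int n}" using subsetsP(1,2) by (force simp: cells_def)
  then have fin: "finite ?O" by (rule finite_subset) simp
  have N: "?N \<notin> ?O" using new_not_one(1)[OF subsetsP(1,2)] by auto
  have "{c. (?m, c) \<in> snd (extend n T S) \<and> ?m \<noteq> - c} = (if ?m \<in> S then insert ?N ?O else ?O)"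
    using m by (auto simp: in_ones_extend)
  moreover have "\<bar>?m\<bar> \<in> fst (extend n T S) \<longleftrightarrow> \<bar>?m\<bar> \<in> fst T"
    using m by (auto simp: extend_def)
  moreover have "rightmost_restricted_zero (Suc n) (extend n T S) r \<bar>?m\<bar>
      \<longleftrightarrow> rightmost_restricted_zero n T r \<bar>?m\<bar>" for r
    using m by (auto simp: rightmost_restricted_zero_def restricted_zero_extend[OF subsetsP])
  ultimately show ?thesis
    using fin N by (simp add: top01_def topmost_unrestricted_row_extend[OF assms] Let_def)
qed

end

section \<open>Recursion for the generating function and the induction\<close>

lemma PT_B_0: "PT_B 0 = {({}, {})}"
  by (auto simp: PT_B_def cells_def zero_at_def)

lemma top01_extend_empty: "top01 (Suc 0) (extend 0 ({}, {}) {}) = 0"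
proof -
  have "unrestricted_rows (Suc 0) ({}, {}) = {1}"
    by (auto simp: unrestricted_rows_def row_labels_def restricted_zero_def zero_at_def cells_def)
  then show ?thesis
    by (simp add: top01_def extend_def topmost_unrestricted_row_def)
qed

lemma unrestricted_rows_0: "unrestricted_rows 0 ({}, {}) = {}"
  by (simp add: unrestricted_rows_def row_labels_def)

definition weight :: "nat \<Rightarrow> 'a :: comm_semiring_1 \<Rightarrow> 'a \<Rightarrow> 'a \<Rightarrow> tableau \<Rightarrow> 'a" where
  "weight n x y z T = x ^ (urr n T - 1) * y ^ top01 n T * z ^ diag T"

text \<open>The sets \<open>S\<close> are split by whether they contain the new diagonal row. If so,
  that row absorbs the subtracted 1 in the exponent of \<open>x\<close>, each old unrestricted row
  contributes \<open>x\<close> or \<open>y\<close>, and the binomial sum applies. Length 0 is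
  included, for the base case.\<close>

lemma sum_weight_Suc:
  fixes x y z :: "'a :: comm_semiring_1"
  shows "(\<Sum>T \<in> PT_B (Suc n). weight (Suc n) x y z T) =
    (\<Sum>T \<in> PT_B n. (\<Sum>S \<in> Pow (unrestricted_rows n T). weight (Suc n) x y z (extend n T S))
      + z ^ Suc (diag T) * (x + y) ^ urr n T)"
proof -
  let ?N = "1 + int n"
  have "(\<Sum>T \<in> PT_B (Suc n). weight (Suc n) x y z T) =
      (\<Sum>(T, S) \<in> (SIGMA T : PT_B n. Pow (extension_rows n T)). weight (Suc n) x y z (extend n T S))"
    using sum.reindex_bij_betw[OF bij_betw_extend, of "weight (Suc n) x y z" n]
    by (simp add: case_prod_unfold)
  also have "\<dots> = (\<Sum>T \<in> PT_B n. \<Sum>S \<in> Pow (extension_rows n T). weight (Suc n) x y z (extend n T S))"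
    using finite_PT_B finite_unrestricted_rows
    by (subst sum.Sigma) (auto simp: extension_rows_def)
  also have "\<dots> = (\<Sum>T \<in> PT_B n. (\<Sum>S \<in> Pow (unrestricted_rows n T). weight (Suc n) x y z (extend n T S))
      + z ^ Suc (diag T) * (x + y) ^ urr n T)"
  proof (rule sum.cong[OF refl])
    fix T assume T: "T \<in> PT_B n"
    let ?U = "unrestricted_rows n T"
    note fin = finite_unrestricted_rows[OF T]
    have N: "- ?N \<notin> ?U"
      using unrestricted_rows_bounds(1)[OF PT_B_subsets(1)[OF T], of "- ?N"] by auto
    have "weight (Suc n) x y z (extend n T (insert (- ?N) S)) =
        z ^ Suc (diag T) * (x ^ card S * y ^ card (?U - S))" if "S \<in> Pow ?U" for S
    proof -
      have S: "insert (- ?N) S \<subseteq> extension_rows n T"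
        using that by (auto simp: extension_rows_def)
      have "finite S" "- ?N \<notin> S" using that fin N by (auto intro: finite_subset)
      then have "urr (Suc n) (extend n T (insert (- ?N) S)) = Suc (card S)"
        using unrestricted_rows_extend[OF PT_B_subsets[OF T] subset_trans[OF S extension_rows_subset] S]
        by (simp add: urr_def)
      moreover have "?U - insert (- ?N) S = ?U - S" using N by auto
      ultimately show ?thesis
        using diag_extend[OF T S] top01_extend_diagonal[OF T S] by (simp add: weight_def mult_ac)
    qed
    then have "(\<Sum>S \<in> Pow ?U. weight (Suc n) x y z (extend n T (insert (- ?N) S))) =
        z ^ Suc (diag T) * (x + y) ^ urr n T"
      by (simp add: sum_distrib_left[symmetric] sum_Pow_binomial[OF fin] urr_def del: power_Suc)
    then show "(\<Sum>S \<in> Pow (extension_rows n T). weight (Suc n) x y z (extend n T S)) =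
      (\<Sum>S \<in> Pow ?U. weight (Suc n) x y z (extend n T S)) + z ^ Suc (diag T) * (x + y) ^ urr n T"
      unfolding extension_rows_def sum_Pow_insert[OF fin N] by (rule arg_cong)
  qed
  finally show ?thesis .
qed

text \<open>Splitting off the topmost unrestricted row, whose count cancels the subtracted 1, leaves
  subsets of \<open>V\<close>. Those without the top row sum to a multiple of
  \<open>x * (1 + x) ^ card V\<close>, those with it to the same multiple of
  \<open>y * (1 + x) ^ card V\<close>.\<close>

lemma sum_weight_extend:
  fixes x y z :: "'a :: comm_semiring_1"
  assumes T: "T \<in> PT_B n" and n: "n \<ge> 1"
  shows "(\<Sum>S \<in> Pow (unrestricted_rows n T). weight (Suc n) x y z (extend n T S))
    = (x + y) * weight n (1 + x) y z T"
proof -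
  let ?U = "unrestricted_rows n T" and ?m = "topmost_unrestricted_row n T"
  define V where "V = ?U - {?m}"
  note fin = finite_unrestricted_rows[OF T] and ne = unrestricted_rows_nonempty[OF T n]
  have finV: "finite V" using fin by (simp add: V_def)
  have m: "?m \<notin> V" and U: "?U = insert ?m V" and min: "\<And>r. r \<in> V \<Longrightarrow> ?m < r"
    using fin Min_in[OF fin ne] by (auto simp: V_def topmost_unrestricted_row_def less_le)
  have card_V: "card V = urr n T - 1"
    using finV m by (simp add: urr_def U)
  let ?w = "\<lambda>T. y ^ top01 n T * z ^ diag T"
  have N: "- (1 + int n) \<notin> ?U" "1 + int n \<notin> ?U"
    using unrestricted_rows_bounds[OF PT_B_subsets(1)[OF T]] by force+
  have unr: "unrestricted_rows (Suc n) (extend n T S) =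
      (if S = {} then insert (1 + int n) ?U else kept ?U S)"
    and ext: "S \<subseteq> extension_rows n T" "- (1 + int n) \<notin> S" if "S \<subseteq> ?U" for S
  proof -
    show *: "S \<subseteq> extension_rows n T" "- (1 + int n) \<notin> S"
      using that N by (auto simp: extension_rows_def)
    show "unrestricted_rows (Suc n) (extend n T S) =
        (if S = {} then insert (1 + int n) ?U else kept ?U S)"
      using * unrestricted_rows_extend[OF PT_B_subsets[OF T] subset_trans[OF *(1) extension_rows_subset] *(1)]
      by simp
  qed
  have without_top: "weight (Suc n) x y z (extend n T S) =
      ?w T * x ^ (card (kept V S) + (if S = {} then 1 else 0))" if "S \<in> Pow V" for S
  proof -
    have S: "S \<subseteq> ?U" "?m \<notin> S" using that U m by auto
    have "?m \<notin> kept V S" using m by (simp add: kept_def)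
    then have "urr (Suc n) (extend n T S) = Suc (card (kept V S) + (if S = {} then 1 else 0))"
      using unr[OF S(1)] fin N finV that kept_insert_min(1)[OF min, of V S] finite_kept[OF finV, of S]
      by (auto simp: urr_def U kept_def m)
    then show ?thesis
      using S top01_extend[OF T ext[OF S(1)] n] diag_extend[OF T ext(1)[OF S(1)]] ext(2)[OF S(1)]
      by (simp add: weight_def mult_ac)
  qed
  have with_top: "weight (Suc n) x y z (extend n T (insert ?m S)) =
      y * (?w T * (x ^ card S * 1 ^ card (V - S)))" if "S \<in> Pow V" for S
  proof -
    have S: "insert ?m S \<subseteq> ?U" using that U by auto
    have "?m \<notin> S" "finite S" using m that finV by (auto intro: finite_subset)
    then have "urr (Suc n) (extend n T (insert ?m S)) = Suc (card S)"
      using unr[OF S] that kept_insert_min(2)[OF min, of V S] by (simp add: urr_def U)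
    then show ?thesis
      using top01_extend[OF T ext[OF S] n] diag_extend[OF T ext(1)[OF S]] ext(2)[OF S]
      by (simp add: weight_def mult_ac)
  qed
  have "(\<Sum>S \<in> Pow ?U. weight (Suc n) x y z (extend n T S)) =
      (\<Sum>S \<in> Pow V. ?w T * x ^ (card (kept V S) + (if S = {} then 1 else 0)))
      + (\<Sum>S \<in> Pow V. y * (?w T * (x ^ card S * 1 ^ card (V - S))))"
    unfolding U sum_Pow_insert[OF finV m] using without_top with_top by simp
  also have "\<dots> = ?w T * (x * (1 + x) ^ card V) + y * (?w T * (x + 1) ^ card V)"
    unfolding sum_distrib_left[symmetric] sum_Pow_kept[OF finV] sum_Pow_binomial[OF finV] ..
  also have "\<dots> = (x + y) * weight n (1 + x) y z T"
    by (simp add: weight_def card_V algebra_simps)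
  finally show ?thesis .
qed

text \<open>The induction varies \<open>x\<close> and \<open>y\<close> because the recursion
  evaluates at \<open>(1 + x, y)\<close> and \<open>(x + y, 1)\<close>.\<close>

lemma sum_weight:
  fixes x y z :: "'a :: comm_semiring_1"
  shows "(\<Sum>T \<in> PT_B (Suc n). weight (Suc n) x y z T) = (1 + z) ^ Suc n * pochhammer (x + y) n"
proof (induction n arbitrary: x y)
  case 0
  have "({}, {}) \<in> PT_B 0" by (simp add: PT_B_0)
  from diag_extend[OF this, of "{}"]
  have "diag (extend 0 ({}, {}) {}) = 0" by (simp add: diag_def)
  moreover have "urr (Suc 0) (extend 0 ({}, {}) {}) = 1"
    using unrestricted_rows_extend[of "({}, {})" 0 "{}"] by (simp add: urr_def unrestricted_rows_0)
  ultimately have "weight (Suc 0) x y z (extend 0 ({}, {}) {}) = 1"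
    by (simp add: weight_def top01_extend_empty[simplified])
  then show ?case
    \<comment> \<open>From the empty tableau, the empty bottom row contributes 1 and the single
      diagonal 1 contributes \<open>z\<close>.\<close>
    by (subst sum_weight_Suc) (simp add: PT_B_0 unrestricted_rows_0 urr_def diag_def)
next
  case (Suc n)
  let ?n = "Suc n"
  \<comment> \<open>Setting the second variable to 1 forgets \<open>top01\<close>, and
    \<open>urr > 0\<close> allows one factor \<open>x + y\<close> to be split off.\<close>
  have "z ^ Suc (diag T) * (x + y) ^ urr ?n T = z * (x + y) * weight ?n (x + y) 1 z T"
    if T: "T \<in> PT_B ?n" for T
  proof -
    have "urr ?n T > 0"
      using finite_unrestricted_rows[OF T] unrestricted_rows_nonempty[OF T]
      by (simp add: urr_def card_gt_0_iff)
    then have "(x + y) ^ urr ?n T = (x + y) * (x + y) ^ (urr ?n T - 1)"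
      by (simp add: power_eq_if)
    then show ?thesis by (simp add: weight_def mult_ac)
  qed
  then have "(\<Sum>T \<in> PT_B (Suc ?n). weight (Suc ?n) x y z T) =
      (x + y) * (\<Sum>T \<in> PT_B ?n. weight ?n (1 + x) y z T)
      + z * (x + y) * (\<Sum>T \<in> PT_B ?n. weight ?n (x + y) 1 z T)"
    by (simp add: sum_weight_Suc[of ?n] sum_weight_extend sum.distrib sum_distrib_left del: power_Suc)
  also have "\<dots> = (1 + z) * ((1 + z) ^ ?n * ((x + y) * pochhammer (x + y + 1) n))"
    unfolding Suc.IH by (simp add: algebra_simps)
  finally show ?case by (simp add: pochhammer_rec mult_ac)
qed

theorem theorem1p4:
  fixes n :: nat and x y z :: "'a :: comm_semiring_1"
  assumes "n \<ge> 1"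
  shows "(\<Sum>T \<in> PT_B n. x ^ (urr n T - 1) * y ^ top01 n T * z ^ diag T)
       = (1 + z) ^ n * pochhammer (x + y) (n - 1)"
  using sum_weight[of "n - 1" x y z] assms by (simp add: weight_def)

end
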